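(* Let $c_1,c_2,c_3$ be numbers and let the sequence $[S_n,n\ge0]$ be defined by $S_0=1$, $S_1=c_1$, and $S_{n+1}=c_2S_n+c_3S_{n-1}$ for $n\ge1$. Let $[T_n,n\ge0]$ be its run length transform. Then $T_0=1$ and, for all $t>0$, $$T_{2t}=T_t,\qquad T_{4t+1}=c_1T_t,\qquad T_{4t+3}=c_2T_{2t+1}+c_3T_t.$$
   Context: For an integer $n\ge0$, $\mathcal{L}(n)$ is the list of lengths of the maximal runs of 1s in the binary expansion of $n$ (e.g. $\mathcal{L}(55)=[2,3]$ since $55=110111_2$; $\mathcal{L}(0)$ is empty). The run length transform of a sequence $[S_n,n\ge0]$ is the sequence $[T_n,n\ge0]$ given by $T_n=\prod_{i\in\mathcal{L}(n)}S_i$ (empty product equal to 1). *)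

theory Defs
  imports Main
begin

(* Bit positions are counted from the least significant bit, so the run occupies the
   positions a, ..., a + l - 1 of the binary expansion of n. *)
definition maximal_one_run :: "nat \<Rightarrow> nat \<Rightarrow> nat \<Rightarrow> bool" where
  "maximal_one_run n a l \<longleftrightarrow>
     0 < l \<and> (\<forall>j<l. bit n (a + j)) \<and> \<not> bit n (a + l) \<and> (a = 0 \<or> \<not> bit n (a - 1))"

(* The runs are listed from the most significant one down, i.e. as they are read in the
   usual notation of n; two distinct maximal runs never have the same start position, but
   may have the same length, and then the length is listed repeatedly. *)
definition run_lengths :: "nat \<Rightarrow> nat list" where
  "run_lengths n =
     map (\<lambda>a. THE l. maximal_one_run n a l)
         (rev (sorted_list_of_set {a. \<exists>l. maximal_one_run n a l}))"

definition run_length_transform :: "(nat \<Rightarrow> 'a::monoid_mult) \<Rightarrow> nat \<Rightarrow> 'a" where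
  "run_length_transform S n = prod_list (map S (run_lengths n))"

lemma maximal_one_run_unique:
  assumes "maximal_one_run n a l" and "maximal_one_run n a l'"
  shows "l = l'"
  using assms unfolding maximal_one_run_def by (metis linorder_neqE_nat)

lemma finite_run_starts: "finite {a. \<exists>l. maximal_one_run n a l}"
proof (rule finite_subset)
  show "{a. \<exists>l. maximal_one_run n a l} \<subseteq> {..n}"
  proof
    fix a assume "a \<in> {a. \<exists>l. maximal_one_run n a l}"
    then have "bit n a"
      by (auto simp: maximal_one_run_def dest: spec[of _ 0])
    then have "n div 2 ^ a \<noteq> 0"
      by (metis bit_iff_odd even_zero)
    then have "2 ^ a \<le> n"
      by (meson div_less not_le)
    then show "a \<in> {..n}"
      by (metis atMost_iff less_exp less_imp_le order_trans)
  qed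
qed simp

lemma run_lengths_0: "run_lengths 0 = []"
  by (simp add: run_lengths_def maximal_one_run_def)

lemma run_lengths_55: "run_lengths 55 = [2, 3]"
proof -
  have bits: "bit (55::nat) k \<longleftrightarrow> k \<in> {0, 1, 2, 4, 5}" for k
  proof (cases "k < 6")
    case True
    then have "k \<in> {0, 1, 2, 3, 4, 5}" by auto
    then show ?thesis by (auto simp: bit_iff_odd)
  next
    case False
    then have "(2::nat) ^ 6 \<le> 2 ^ k" by (intro power_increasing) auto
    then have "(55::nat) div 2 ^ k = 0" by simp
    then show ?thesis using False by (auto simp: bit_iff_odd)
  qed
  have r0: "maximal_one_run 55 0 3"
    by (auto simp: maximal_one_run_def bits)
  have r4: "maximal_one_run 55 4 2"
    by (auto simp: maximal_one_run_def bits)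
  have "a = 0 \<or> a = 4" if "maximal_one_run 55 a l" for a l
  proof -
    from that have "bit (55::nat) a" and "a = 0 \<or> \<not> bit (55::nat) (a - 1)"
      by (auto simp: maximal_one_run_def dest: spec[of _ 0])
    then show ?thesis by (auto simp: bits)
  qed
  with r0 r4 have starts: "{a. \<exists>l. maximal_one_run 55 a l} = {0, 4}" by blast
  have "(THE l. maximal_one_run 55 0 l) = 3" "(THE l. maximal_one_run 55 4 l) = 2"
    using r0 r4 maximal_one_run_unique by (blast intro: the_equality)+
  then show ?thesis by (simp add: run_lengths_def starts)
qed

end

(* Every t is uniquely of the form 2^k (2u + 1) - 1, that is, its binary expansion is that of u
   followed by a 0 and then by k ones. Since S 0 = 1 this gives T t = S k * T u also for k = 0.
   Appending further ones to t only changes k, so the recurrence of S passes to T. *)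
theory Submission
  imports Defs
begin

text \<open>Induction on \<open>k\<close>: one more trailing one sends \<open>m\<close> to
  \<open>2 * m + 1\<close>, which moves every bit up one place. Position \<open>k\<close> holds the
  separating zero, hence the shift by \<open>Suc k\<close>.\<close>

lemma bit_append_ones_iff:
  "bit (2 ^ k * (2 * n + 1) - 1 :: nat) i \<longleftrightarrow> i < k \<or> (k < i \<and> bit n (i - Suc k))"
proof (induction k arbitrary: i)
  case 0
  show ?case
    by (cases i) (simp_all add: bit_Suc bit_0)
next
  case (Suc k)
  define m :: nat where "m = 2 ^ k * (2 * n + 1) - 1"
  \<comment> \<open>Positivity makes the truncated subtraction in \<open>m\<close> exact.\<close>
  have "(1::nat) \<le> 2 ^ k * (2 * n + 1)"
    by (simp add: Suc_le_eq)
  then have "2 ^ Suc k * (2 * n + 1) - 1 = Suc (2 * m)"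
    unfolding power_Suc mult.assoc m_def by linarith
  then show ?case
    using Suc.IH[folded m_def] by (cases i) (simp_all only: bit_Suc bit_0, simp_all)
qed

text \<open>The zero at position \<open>k\<close> keeps the trailing ones apart from the bits of
  \<open>n\<close>, so no run crosses it.\<close>

lemma maximal_one_run_append_ones_iff:
  "maximal_one_run (2 ^ k * (2 * n + 1) - 1) a l \<longleftrightarrow>
     (0 < k \<and> a = 0 \<and> l = k) \<or> (k < a \<and> maximal_one_run n (a - Suc k) l)"
  (is "maximal_one_run ?m a l \<longleftrightarrow> _")
proof (cases "k < a")
  case True
  then obtain b where a: "a = b + Suc k"
    by (metis Suc_leI le_add_diff_inverse2)
  have "bit ?m (a + j) \<longleftrightarrow> bit n (b + j)" for j
    unfolding bit_append_ones_iff a by (simp add: algebra_simps)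
  \<comment> \<open>For \<open>b = 0\<close> the bit before the run is the separating zero, which
    matches the boundary case of a run of \<open>n\<close> starting at position 0.\<close>
  moreover have "bit ?m (a - 1) \<longleftrightarrow> b \<noteq> 0 \<and> bit n (b - 1)"
    unfolding bit_append_ones_iff a by auto
  ultimately show ?thesis
    unfolding maximal_one_run_def using a by auto
next
  case False
  \<comment> \<open>A run starting among the trailing ones extends down to position 0 by maximality.
    If \<open>l < k\<close>, a one would follow it; if \<open>k < l\<close>, it would contain the
    separating zero.\<close>
  have "0 < k \<and> a = 0 \<and> l = k" if run: "maximal_one_run ?m a l"
  proof -
    have "bit ?m a"
      using run unfolding maximal_one_run_def by (metis add.right_neutral)
    then have "a < k"
      using False unfolding bit_append_ones_iff by simp
    then have "a = 0"
      using run unfolding maximal_one_run_def bit_append_ones_iff by auto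
    moreover have "\<not> l < k"
      using run \<open>a = 0\<close> unfolding maximal_one_run_def bit_append_ones_iff by simp
    moreover have "\<not> k < l"
      using run \<open>a = 0\<close> unfolding maximal_one_run_def bit_append_ones_iff by auto
    ultimately show ?thesis
      using \<open>a < k\<close> by simp
  qed
  moreover have "maximal_one_run ?m 0 k" if "0 < k"
    using that unfolding maximal_one_run_def bit_append_ones_iff by simp
  ultimately show ?thesis
    using False by auto
qed

text \<open>Commutativity removes the order of the runs; a product over the set of starts can be
  split and reindexed.\<close>

lemma run_length_transform_eq_prod:
  fixes S :: "nat \<Rightarrow> 'a::comm_monoid_mult"
  shows "run_length_transform S n =
    (\<Prod>a | \<exists>l. maximal_one_run n a l. S (THE l. maximal_one_run n a l))"
  unfolding run_length_transform_def run_lengths_def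
  using prod.distinct_set_conv_list
    [of "rev (sorted_list_of_set {a. \<exists>l. maximal_one_run n a l})"
        "\<lambda>a. S (THE l. maximal_one_run n a l)"]
  by (simp add: finite_run_starts o_def)

lemma run_length_transform_append_ones:
  fixes S :: "nat \<Rightarrow> 'a::comm_monoid_mult"
  assumes "S 0 = 1"
  shows "run_length_transform S (2 ^ k * (2 * n + 1) - 1) = S k * run_length_transform S n"
proof -
  define m where "m = 2 ^ k * (2 * n + 1) - 1"
  note run_iff = maximal_one_run_append_ones_iff[of k n, folded m_def]
  let ?A = "{a. \<exists>l. maximal_one_run n a l}"
  let ?B = "if k = 0 then {} else {0::nat}"
  let ?f = "\<lambda>a. S (THE l. maximal_one_run m a l)"
  \<comment> \<open>The guard \<open>k < a\<close> makes \<open>a - Suc k\<close> a genuine inverse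
    of the shift.\<close>
  have "a \<in> (\<lambda>a. a + Suc k) ` ?A \<longleftrightarrow> k < a \<and> (\<exists>l. maximal_one_run n (a - Suc k) l)" for a
    by (cases "k < a") (auto simp: image_iff intro: exI[where x = "a - Suc k"])
  then have starts: "{a. \<exists>l. maximal_one_run m a l} = ?B \<union> (\<lambda>a. a + Suc k) ` ?A"
    unfolding set_eq_iff Un_iff by (auto simp: run_iff)
  have "run_length_transform S m = prod ?f ?B * prod ?f ((\<lambda>a. a + Suc k) ` ?A)"
    unfolding run_length_transform_eq_prod starts
    by (rule prod.union_disjoint) (auto simp: finite_run_starts)
  \<comment> \<open>For \<open>k = 0\<close> the product is empty and \<open>S 0 = 1\<close>
    supplies its value.\<close>
  also have "prod ?f ?B = S k"
    using assms by (simp add: run_iff)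
  also have "prod ?f ((\<lambda>a. a + Suc k) ` ?A) = run_length_transform S n"
  proof -
    \<comment> \<open>Equality as predicates of the length makes the two \<open>THE\<close> terms
      coincide.\<close>
    have "maximal_one_run m (a + Suc k) = maximal_one_run n a" for a
      by (rule ext) (simp add: run_iff)
    then show ?thesis
      unfolding run_length_transform_eq_prod by (subst prod.reindex) (simp_all add: inj_on_def)
  qed
  finally show ?thesis
    unfolding m_def .
qed

lemma nat_append_ones_cases:
  obtains k u :: nat where "t = 2 ^ k * (2 * u + 1) - 1"
proof -
  \<comment> \<open>Even \<open>t\<close> gives \<open>k = 0\<close>; for
    \<open>t = 2 * s + 1\<close>, \<open>Suc t\<close> is twice \<open>Suc s\<close>, so
    \<open>k\<close> grows by one.\<close>
  have "\<exists>k u. Suc t = 2 ^ k * (2 * u + 1)"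
  proof (induction t rule: less_induct)
    case (less t)
    show ?case
    proof (cases "even t")
      case True
      then obtain u where "t = 2 * u" ..
      then have "Suc t = 2 ^ 0 * (2 * u + 1)"
        by simp
      then show ?thesis
        by blast
    next
      case False
      then obtain s where s: "t = 2 * s + 1"
        by (rule oddE)
      then have "s < t"
        by simp
      then obtain k u where "Suc s = 2 ^ k * (2 * u + 1)"
        using less.IH by blast
      with s have "Suc t = 2 ^ Suc k * (2 * u + 1)"
        by simp
      then show ?thesis
        by blast
    qed
  qed
  then show ?thesis
    using that by (metis diff_Suc_1)
qed

theorem theorem3:
  fixes c1 c2 c3 :: "'a::comm_ring_1" and S T :: "nat \<Rightarrow> 'a"
  assumes "S 0 = 1"
    and "S 1 = c1"
    and "\<And>n. n \<ge> 1 \<Longrightarrow> S (n + 1) = c2 * S n + c3 * S (n - 1)"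
    and "T = run_length_transform S"
  shows "T 0 = 1 \<and>
    (\<forall>t>0. T (2 * t) = T t \<and>
           T (4 * t + 1) = c1 * T t \<and>
           T (4 * t + 3) = c2 * T (2 * t + 1) + c3 * T t)"
proof (intro conjI allI impI)
  have T: "T (2 ^ k * (2 * n + 1) - 1) = S k * T n" for k n
    using run_length_transform_append_ones[of S k n] assms by simp
  show "T 0 = 1"
    by (simp add: assms(4) run_length_transform_def run_lengths_0)
  fix t :: nat
  show "T (2 * t) = T t"
    using T[of 0 t] assms(1) by simp
  show "T (4 * t + 1) = c1 * T t"
    using T[of 1 t] assms(2) by simp
  \<comment> \<open>The numbers \<open>t\<close>, \<open>2 * t + 1\<close> and
    \<open>4 * t + 3\<close> share \<open>u\<close> and end in \<open>k\<close>,
    \<open>k + 1\<close> and \<open>k + 2\<close> ones.\<close>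
  obtain k u where t: "t = 2 ^ k * (2 * u + 1) - 1"
    by (rule nat_append_ones_cases)
  have "Suc t = 2 ^ k * (2 * u + 1)"
    using t by simp
  then have "2 * t + 1 = 2 ^ (k + 1) * (2 * u + 1) - 1"
    and "4 * t + 3 = 2 ^ (k + 2) * (2 * u + 1) - 1"
    by (simp_all add: power_add)
  then have "T t = S k * T u" "T (2 * t + 1) = S (k + 1) * T u" "T (4 * t + 3) = S (k + 2) * T u"
    using t T by metis+
  \<comment> \<open>The index \<open>k + 1\<close> is at least 1, so the recurrence applies even
    when \<open>t\<close> is even.\<close>
  moreover have "S (k + 2) = c2 * S (k + 1) + c3 * S k"
    using assms(3)[of "k + 1"] by simp
  ultimately show "T (4 * t + 3) = c2 * T (2 * t + 1) + c3 * T t"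
    by (simp add: algebra_simps)
qed

end
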